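(* For any non-negative integer $N$, $$\begin{aligned} pG(2,1,1;6N)&=rP(1,1,2;N),\\ pG(2,1,1;6N+1)&=2\,rtp(3,2,1;N),\\ pG(2,1,1;6N+2)&=2\,rtp(1,3,2;N),\\ pG(2,1,1;6N+3)&=2\,tpg(2,1,1;N),\\ pG(2,1,1;6N+4)&=2\,rtp(1,6,1;N),\\ pG(2,1,1;6N+5)&=4\,Tg(2,3,1;N). \end{aligned}$$
   Context: $\mathbb{N}_0=\{0,1,2,\dots\}$. $t_n=n(n+1)/2$ (triangular numbers, $n\in\mathbb{N}_0$), $p_n=n(3n+1)/2$ (generalized pentagonal numbers, $n\in\mathbb{Z}$), $g_n=n(3n+2)$ (generalized octagonal numbers, $n\in\mathbb{Z}$). For positive integers $a_1,a_2,a_3$ and $N\in\mathbb{N}_0$: $pG(a_1,a_2,a_3;N)=|\{(l,m,n)\in\mathbb{Z}^3: N=a_1p_l+a_2g_m+a_3g_n\}|$; $rP(a_1,a_2,a_3;N)=|\{(l,m,n)\in\mathbb{Z}^3: N=a_1l^2+a_2p_m+a_3p_n\}|$; $rtp(a_1,a_2,a_3;N)=|\{(l,m,n)\in\mathbb{Z}\times\mathbb{N}_0\times\mathbb{Z}: N=a_1l^2+a_2t_m+a_3p_n\}|$; $tpg(a_1,a_2,a_3;N)=|\{(l,m,n)\in\mathbb{N}_0\times\mathbb{Z}^2: N=a_1t_l+a_2p_m+a_3g_n\}|$; $Tg(a_1,a_2,a_3;N)=|\{(l,m,n)\in\mathbb{N}_0^2\times\mathbb{Z}: N=a_1t_l+a_2t_m+a_3g_n\}|$.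 *)

theory Defs
  imports Main
begin

text \<open>Both divisions by 2 are exact. The pentagonal and octagonal numbers are indexed by all
  integers (the generalized ones), the triangular numbers by the naturals only.\<close>

definition triangular :: "nat \<Rightarrow> nat" where
  "triangular n = n * (n + 1) div 2"

definition pentagonal :: "int \<Rightarrow> int" where
  "pentagonal n = n * (3 * n + 1) div 2"

definition octagonal :: "int \<Rightarrow> int" where
  "octagonal n = n * (3 * n + 2)"

text \<open>Representation numbers. The coefficients are meant to be positive: then every solution set
  is finite, because each figurate number is nonnegative and takes each value only finitely
  often, and \<^const>\<open>card\<close> is the true number of solutions.
  (For an infinite set \<^const>\<open>card\<close> would be 0.)\<close>

definition pG :: "nat \<Rightarrow> nat \<Rightarrow> nat \<Rightarrow> nat \<Rightarrow> nat" where
  "pG a1 a2 a3 N = card {(l :: int, m :: int, n :: int).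
     int N = int a1 * pentagonal l + int a2 * octagonal m + int a3 * octagonal n}"

definition rP :: "nat \<Rightarrow> nat \<Rightarrow> nat \<Rightarrow> nat \<Rightarrow> nat" where
  "rP a1 a2 a3 N = card {(l :: int, m :: int, n :: int).
     int N = int a1 * l\<^sup>2 + int a2 * pentagonal m + int a3 * pentagonal n}"

definition rtp :: "nat \<Rightarrow> nat \<Rightarrow> nat \<Rightarrow> nat \<Rightarrow> nat" where
  "rtp a1 a2 a3 N = card {(l :: int, m :: nat, n :: int).
     int N = int a1 * l\<^sup>2 + int a2 * int (triangular m) + int a3 * pentagonal n}"

definition tpg :: "nat \<Rightarrow> nat \<Rightarrow> nat \<Rightarrow> nat \<Rightarrow> nat" where
  "tpg a1 a2 a3 N = card {(l :: nat, m :: int, n :: int).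
     int N = int a1 * int (triangular l) + int a2 * pentagonal m + int a3 * octagonal n}"

definition Tg :: "nat \<Rightarrow> nat \<Rightarrow> nat \<Rightarrow> nat \<Rightarrow> nat" where
  "Tg a1 a2 a3 N = card {(l :: nat, m :: nat, n :: int).
     int N = int a1 * int (triangular l) + int a2 * int (triangular m) + int a3 * octagonal n}"

end

theory Submission
  imports Defs
begin

text \<open>
  Completing squares, \<open>M = 2 p\<^sub>l + g\<^sub>m + g\<^sub>n\<close> becomes \<open>12 M + 9 = x\<^sup>2 + 4 y\<^sup>2 + 4 z\<^sup>2\<close> with
  \<open>x = 6 l + 1\<close>, \<open>y = 3 m + 1\<close>, \<open>z = 3 n + 1\<close>, that is, \<open>x\<^sup>2 + 2 a\<^sup>2 + 2 b\<^sup>2\<close> with \<open>a = y + z\<close> and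
  \<open>b = y - z = 3 e\<close>. As \<open>x \<equiv> - a (mod 3)\<close>, multiplying \<open>x + a \<surd>-2\<close> by \<open>(1 + \<surd>-2) / 3\<close> gives
  \<open>4 M + 3 = c\<^sup>2 + 2 d\<^sup>2 + 6 e\<^sup>2\<close> with \<open>c = 2 (l - m - n) - 1\<close>, \<open>d = 2 l + m + n + 1\<close> and
  \<open>e = m - n\<close>. The residue of \<open>M\<close> modulo 6 determines \<open>l - m - n\<close> modulo 3 and \<open>m + n\<close> modulo 2,
  hence \<open>c\<close> and \<open>d\<close> modulo 6 and \<open>e\<close> modulo 2. Writing \<open>c\<close>, \<open>d\<close>, \<open>e\<close> in terms of these residues and
  undoing the completion of squares gives the six identities, except that each triangular number
  is indexed by an integer; folding that index to the naturals contributes a factor 2.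
\<close>

definition int_triangular :: "int \<Rightarrow> int" where
  "int_triangular k = k * (k + 1) div 2"

lemma double_int_triangular: "2 * int_triangular k = k * (k + 1)"
  unfolding int_triangular_def by simp

lemma double_pentagonal: "2 * pentagonal k = k * (3 * k + 1)"
  unfolding pentagonal_def by simp

lemma int_triangular_of_nat: "int_triangular (int k) = int (triangular k)"
  unfolding int_triangular_def triangular_def by (simp add: zdiv_int algebra_simps)

lemma int_triangular_reflect: "int_triangular (- k - 1) = int_triangular k"
  unfolding int_triangular_def by (simp add: algebra_simps)

text \<open>The indices \<open>k\<close> and \<open>- k - 1\<close> share their value, and exactly
  one of them is nonnegative; the Boolean in the bijection records which.\<close>

lemma card_fold_triangular:
  "card {(k, z). P (int_triangular k) z} = 2 * card {(k, z). P (int (triangular k)) z}"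
proof -
  let ?f = "\<lambda>(s, k, z). (if s then int k else - int k - 1, z)"
  have "bij_betw ?f (UNIV \<times> {(k, z). P (int (triangular k)) z}) {(k, z). P (int_triangular k) z}"
    by (rule bij_betw_byWitness
        [where f' = "\<lambda>(k, z). (k \<ge> 0, nat (if k \<ge> 0 then k else - k - 1), z)"])
      (clarsimp, clarsimp, (auto simp: int_triangular_of_nat int_triangular_reflect)[],
        clarsimp simp: int_triangular_reflect simp flip: int_triangular_of_nat)
  then show ?thesis
    by (simp flip: bij_betw_same_card add: card_cartesian_product)
qed

lemma card_swap: "card {(x, k, y). P x k y} = card {(k, x, y). P x k y}"
  by (rule bij_betw_same_card[of "\<lambda>(x, k, y). (k, x, y)"],
      rule bij_betw_byWitness[where f' = "\<lambda>(k, x, y). (x, k, y)"]) auto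

lemma card_fold_triangular_middle:
  "card {(x, k, y). P x (int_triangular k) y} = 2 * card {(x, k, y). P x (int (triangular k)) y}"
  unfolding card_swap[of "\<lambda>x k y. P x (int_triangular k) y"]
    card_swap[of "\<lambda>x k y. P x (int (triangular k)) y"]
  by (rule card_fold_triangular)

theorem theorem5p14:
  fixes N :: nat
  shows "pG 2 1 1 (6 * N) = rP 1 1 2 N
    \<and> pG 2 1 1 (6 * N + 1) = 2 * rtp 3 2 1 N
    \<and> pG 2 1 1 (6 * N + 2) = 2 * rtp 1 3 2 N
    \<and> pG 2 1 1 (6 * N + 3) = 2 * tpg 2 1 1 N
    \<and> pG 2 1 1 (6 * N + 4) = 2 * rtp 1 6 1 N
    \<and> pG 2 1 1 (6 * N + 5) = 4 * Tg 2 3 1 N"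
proof -
  \<comment> \<open>\<open>surj\<close> makes the substitution reach every triple
    \<open>(a, b, c)\<close> with \<open>a - b - c\<close> congruent to \<open>r\<close> modulo 3
    and \<open>b + c\<close> congruent to \<open>r\<close> modulo 2. All solutions lie in this
    class.\<close>
  have pG_reparametrize: "pG 2 1 1 (6 * N + r) = card {(i, j, k). int N = F i j k}"
    if inj: "\<And>i j k i' j' k'. l i j k = l i' j' k' \<Longrightarrow> m i j k = m i' j' k'
        \<Longrightarrow> n i j k = n i' j' k' \<Longrightarrow> i = i' \<and> j = j' \<and> k = k'"
      and surj: "\<And>u v w. \<exists>i j k. l i j k = 3 * u + 2 * v + 2 * int r
        \<and> m i j k = 2 * v + int r - w \<and> n i j k = w"
      and form: "\<And>i j k. 2 * pentagonal (l i j k) + octagonal (m i j k) + octagonal (n i j k)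
        = 6 * F i j k + int r"
    for l m n F :: "int \<Rightarrow> int \<Rightarrow> int \<Rightarrow> int" and r :: nat
  proof -
    let ?f = "\<lambda>(i, j, k). (l i j k, m i j k, n i j k)"
    let ?S = "{(a, b, c). int (6 * N + r) = int 2 * pentagonal a + int 1 * octagonal b
      + int 1 * octagonal c}"
    have "inj ?f"
      by (rule injI) (clarify, use inj in blast)
    moreover have "(a, b, c) \<in> range ?f" if "(a, b, c) \<in> ?S" for a b c
    proof -
      have eq: "6 * int N + int r = 2 * pentagonal a + octagonal b + octagonal c"
        using that by simp
      \<comment> \<open>\<open>2 p\<^sub>a + g\<^sub>b + g\<^sub>c\<close> is congruent to \<open>a - b - c\<close> modulo 3 and to \<open>b + c\<close> modulo 2; \<open>u\<close> and \<open>v\<close> are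
        the quotients in \<open>a - b - c = 3 u + r\<close> and \<open>b + c = 2 v + r\<close>.\<close>
      define u where "u = 2 * int N - (a\<^sup>2 + b\<^sup>2 + c\<^sup>2 + b + c)"
      define v where "v = 3 * int N - (pentagonal a + pentagonal b + pentagonal c)"
      \<comment> \<open>\<open>octagonal x = 2 * pentagonal x + x\<close> for \<open>b\<close> and
        \<open>c\<close> turns \<open>eq\<close> into \<open>2 * v = b + c - r\<close>.\<close>
      have b: "b = 2 * v + int r - c"
        using eq double_pentagonal[of b] double_pentagonal[of c]
        unfolding v_def octagonal_def by algebra
      have a: "a = 3 * u + 2 * v + 2 * int r"
        using eq b double_pentagonal[of a] unfolding u_def octagonal_def by algebra
      obtain i j k where "l i j k = a" and "m i j k = b" and "n i j k = c"
        using surj[of u v c] unfolding a[symmetric] b[symmetric] by blast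
      then show ?thesis by (intro range_eqI[of _ _ "(i, j, k)"]) simp
    qed
    ultimately have "card (?f -` ?S) = card ?S"
      by (intro card_vimage_inj) auto
    moreover have "?f -` ?S = {(i, j, k). int N = F i j k}"
      by (auto simp: form)
    ultimately show ?thesis by (simp only: pG_def)
  qed
  show ?thesis
  proof (intro conjI)
    show "pG 2 1 1 (6 * N) = rP 1 1 2 N"
    proof -
      have "pG 2 1 1 (6 * N + 0) =
          card {(i, k, j). int N = i\<^sup>2 + pentagonal k + 2 * pentagonal j}"
      \<comment> \<open>In the overview's notation, \<open>c = - 6 * k - 1\<close>,
        \<open>d = 6 * j + 1\<close>, \<open>e = 2 * i\<close>.\<close>
      proof (rule pG_reparametrize[where l = "\<lambda>i k j. 2 * j - k"
            and m = "\<lambda>i k j. j + k + i" and n = "\<lambda>i k j. j + k - i"], goal_cases)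
        case 1
        then show ?case by algebra
      next
        case (2 u v w)
        show ?case
          by (rule exI[of _ "v - w"], rule exI[of _ "- u"],
              rule exI[of _ "u + v"]) simp
      next
        case (3 i k j)
        show ?case
          using double_pentagonal[of k] double_pentagonal[of j]
            double_pentagonal[of "2 * j - k"]
          unfolding octagonal_def of_nat_numeral of_nat_1 of_nat_0 by algebra
      qed
      then show ?thesis by (simp add: rP_def)
    qed
  next
    show "pG 2 1 1 (6 * N + 1) = 2 * rtp 3 2 1 N"
    proof -
      have "pG 2 1 1 (6 * N + 1) =
          card {(i, j, k). int N = 3 * i\<^sup>2 + 2 * int_triangular j + pentagonal k}"
      \<comment> \<open>\<open>c = 6 * k + 1\<close>, \<open>d = 6 * i\<close>,
        \<open>e = 2 * j + 1\<close>.\<close>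
      proof (rule pG_reparametrize[where l = "\<lambda>i j k. 2 * i + k"
            and m = "\<lambda>i j k. i - k + j" and n = "\<lambda>i j k. i - k - j - 1"], goal_cases)
        case 1
        then show ?case by algebra
      next
        case (2 u v w)
        show ?case
          by (rule exI[of _ "u + v + 1"], rule exI[of _ "v - w"],
              rule exI[of _ "u"]) simp
      next
        case (3 i j k)
        show ?case
          using double_int_triangular[of j] double_pentagonal[of k]
            double_pentagonal[of "2 * i + k"]
          unfolding octagonal_def of_nat_numeral of_nat_1 of_nat_0 by algebra
      qed
      then show ?thesis
        using card_fold_triangular_middle[of "\<lambda>i t k. int N = 3 * i\<^sup>2 + 2 * t + pentagonal k"]
        by (simp add: rtp_def)
    qed
  next
    show "pG 2 1 1 (6 * N + 2) = 2 * rtp 1 3 2 N"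
    proof -
      have "pG 2 1 1 (6 * N + 2) =
          card {(i, j, k). int N = i\<^sup>2 + 3 * int_triangular j + 2 * pentagonal k}"
      \<comment> \<open>\<open>c = 6 * j + 3\<close>, \<open>d = - 6 * k - 1\<close>,
        \<open>e = 2 * i\<close>.\<close>
      proof (rule pG_reparametrize[where l = "\<lambda>i j k. j - 2 * k"
            and m = "\<lambda>i j k. i - j - k - 1" and n = "\<lambda>i j k. - i - j - k - 1"], goal_cases)
        case 1
        then show ?case by algebra
      next
        case (2 u v w)
        show ?case
          by (rule exI[of _ "v - w + 1"], rule exI[of _ "u"],
              rule exI[of _ "- u - v - 2"]) simp
      next
        case (3 i j k)
        show ?case
          using double_int_triangular[of j] double_pentagonal[of k]
            double_pentagonal[of "j - 2 * k"]
          unfolding octagonal_def of_nat_numeral of_nat_1 of_nat_0 by algebra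
      qed
      then show ?thesis
        using card_fold_triangular_middle[of "\<lambda>i t k. int N = i\<^sup>2 + 3 * t + 2 * pentagonal k"]
        by (simp add: rtp_def)
    qed
  next
    show "pG 2 1 1 (6 * N + 3) = 2 * tpg 2 1 1 N"
    proof -
      have "pG 2 1 1 (6 * N + 3) =
          card {(j, k, i). int N = 2 * int_triangular j + pentagonal k + octagonal i}"
      \<comment> \<open>\<open>c = - 6 * k - 1\<close>, \<open>d = - 6 * i - 2\<close>,
        \<open>e = 2 * j + 1\<close>.\<close>
      proof (rule pG_reparametrize[where l = "\<lambda>j k i. - k - 2 * i - 1"
            and m = "\<lambda>j k i. k - i + j" and n = "\<lambda>j k i. k - i - j - 1"], goal_cases)
        case 1
        then show ?case by algebra
      next
        case (2 u v w)
        show ?case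
          by (rule exI[of _ "v - w + 1"], rule exI[of _ "- u - 1"],
              rule exI[of _ "- u - v - 3"]) simp
      next
        case (3 j k i)
        show ?case
          using double_int_triangular[of j] double_pentagonal[of k]
            double_pentagonal[of "- k - 2 * i - 1"]
          unfolding octagonal_def of_nat_numeral of_nat_1 of_nat_0 by algebra
      qed
      then show ?thesis
        using card_fold_triangular[of "\<lambda>t (k, i). int N = 2 * t + pentagonal k + octagonal i"]
        by (simp add: tpg_def)
    qed
  next
    show "pG 2 1 1 (6 * N + 4) = 2 * rtp 1 6 1 N"
    proof -
      have "pG 2 1 1 (6 * N + 4) =
          card {(i, j, k). int N = i\<^sup>2 + 6 * int_triangular j + pentagonal k}"
      \<comment> \<open>\<open>c = 6 * k + 1\<close>, \<open>d = 6 * j + 3\<close>,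
        \<open>e = 2 * i\<close>.\<close>
      proof (rule pG_reparametrize[where l = "\<lambda>i j k. 2 * j + k + 1"
            and m = "\<lambda>i j k. j - k + i" and n = "\<lambda>i j k. j - k - i"], goal_cases)
        case 1
        then show ?case by algebra
      next
        case (2 u v w)
        show ?case
          by (rule exI[of _ "v - w + 2"], rule exI[of _ "u + v + 3"],
              rule exI[of _ "u + 1"]) simp
      next
        case (3 i j k)
        show ?case
          using double_int_triangular[of j] double_pentagonal[of k]
            double_pentagonal[of "2 * j + k + 1"]
          unfolding octagonal_def of_nat_numeral of_nat_1 of_nat_0 by algebra
      qed
      then show ?thesis
        using card_fold_triangular_middle[of "\<lambda>i t k. int N = i\<^sup>2 + 6 * t + pentagonal k"]
        by (simp add: rtp_def)
    qed
  next
    show "pG 2 1 1 (6 * N + 5) = 4 * Tg 2 3 1 N"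
    proof -
      have "pG 2 1 1 (6 * N + 5) =
          card {(k, j, i). int N = 2 * int_triangular k + 3 * int_triangular j + octagonal i}"
      \<comment> \<open>\<open>c = 6 * j + 3\<close>, \<open>d = 6 * i + 2\<close>,
        \<open>e = 2 * k + 1\<close>.\<close>
      proof (rule pG_reparametrize[where l = "\<lambda>k j i. 2 * i + j + 1"
            and m = "\<lambda>k j i. i - j + k" and n = "\<lambda>k j i. i - j - k - 1"], goal_cases)
        case 1
        then show ?case by algebra
      next
        case (2 u v w)
        show ?case
          by (rule exI[of _ "v - w + 2"], rule exI[of _ "u + 1"],
              rule exI[of _ "u + v + 4"]) simp
      next
        case (3 k j i)
        show ?case
          using double_int_triangular[of k] double_int_triangular[of j]
            double_pentagonal[of "2 * i + j + 1"]
          unfolding octagonal_def of_nat_numeral of_nat_1 of_nat_0 by algebra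
      qed
      \<comment> \<open>Folding \<open>k\<close> and then \<open>j\<close> gives the factor
        4.\<close>
      then show ?thesis
        using card_fold_triangular
            [of "\<lambda>t (j, i). int N = 2 * t + 3 * int_triangular j + octagonal i"]
          card_fold_triangular_middle
            [of "\<lambda>k t i. int N = 2 * int (triangular k) + 3 * t + octagonal i"]
        by (simp add: Tg_def)
    qed
  qed
qed

end
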